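(* For every integer $n\ge 1$, $|\mathcal{S}_n(32;\,2\to 1)| = B_n$, where $B_n$ is the $n$-th Bell number.
   Context: $[n]=\{1,\dots,n\}$, and $\mathcal{S}_n$ is the set of permutations $\pi=\pi_1\pi_2\cdots\pi_n$ of $[n]$ in one-line notation. The permutation $\hat\pi$: for $\pi\in\mathcal{S}_n$, $\hat\pi\in\mathcal{S}_n$ is the permutation whose cycle form is obtained from the word $\pi_1\cdots\pi_n$ by inserting a left parenthesis before each left-to-right maximum (an entry larger than all entries to its left) and a right parenthesis immediately before the next left-to-right maximum, or at the end of the word. A cycle $(c_1,c_2,\dots,c_s)$ means $c_1\mapsto c_2\mapsto\cdots\mapsto c_s\mapsto c_1$. Example: if $\pi=2537164$ then $\hat\pi=(2)(53)(7164)$. Arrow patterns: an arrow pattern of size $k$ is a pair $(\nu;H)$ where $\nu=\nu_1\cdots\nu_m$ is a word of distinct positive integers, $H$ is a collection of arrows $b_i\to c_i$, and the set of all integers appearing in $\nu$ or $H$ is $[k]$. A permutation $\pi\in\mathcal{S}_n$ contains $(\nu;H)$ if there are a set $X=\{x_1<x_2<\cdots<x_k\}\subseteq[n]$ and indices $t_1<\cdots<t_m$ such that $\pi_{t_1}\pi_{t_2}\cdots\pi_{t_m}=x_{\nu_1}x_{\nu_2}\cdots x_{\nu_m}$ and $\hat\pi(x_{b_i})=x_{c_i}$ for every arrow $b_i\to c_i$ in $H$. Otherwise $\pi$ avoids $(\nu;H)$. $\mathcal{S}_n(\nu;H)$ is the set of permutations in $\mathcal{S}_n$ avoiding $(\nu;H)$.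 The Bell number $B_n$ is the number of set partitions of $[n]$. *)

theory Defs
  imports "HOL-Combinatorics.Combinatorics" "HOL-Library.Disjoint_Sets"
begin

text \<open>
  The permutations of \<open>[n]\<close> in one-line notation are the lists in
  \<^term>\<open>permutations_of_set {1..n}\<close>. Values are taken from \<open>{1..n}\<close>, whereas positions in
  a list count from \<open>0\<close>.
\<close>

definition lr_max :: "nat list \<Rightarrow> nat \<Rightarrow> bool" where
  "lr_max w i \<longleftrightarrow> i < length w \<and> (\<forall>j<i. w ! j < w ! i)"

definition lr_max_positions :: "nat list \<Rightarrow> nat list" where
  "lr_max_positions w = filter (lr_max w) [0..<length w]"

text \<open>
  Each left-to-right maximum opens a parenthesis, which closes just before the next
  left-to-right maximum, or at the end of the word for the last one.
\<close>

definition hat_cycles :: "nat list \<Rightarrow> nat list list" where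
  "hat_cycles w =
     map2 (\<lambda>s e. take (e - s) (drop s w))
       (lr_max_positions w) (tl (lr_max_positions w) @ [length w])"

text \<open>
  The library's \<^term>\<open>cycle_of_list [c\<^sub>1, c\<^sub>2, c\<^sub>3]\<close> sends \<open>c\<^sub>1\<close> to \<open>c\<^sub>2\<close>, \<open>c\<^sub>2\<close> to \<open>c\<^sub>3\<close>
  and \<open>c\<^sub>3\<close> to \<open>c\<^sub>1\<close>. The cycles of a permutation are disjoint, so the order of
  composition does not matter.
\<close>

definition hat :: "nat list \<Rightarrow> nat \<Rightarrow> nat" where
  "hat w = foldr (\<circ>) (map cycle_of_list (hat_cycles w)) id"

text \<open>An arrow \<open>b \<rightarrow> c\<close> is the pair \<open>(b, c)\<close>.\<close>

type_synonym arrow_pattern = "nat list \<times> (nat \<times> nat) set"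

definition pattern_letters :: "arrow_pattern \<Rightarrow> nat set" where
  "pattern_letters p = set (fst p) \<union> fst ` snd p \<union> snd ` snd p"

definition is_arrow_pattern :: "nat \<Rightarrow> arrow_pattern \<Rightarrow> bool" where
  "is_arrow_pattern k p \<longleftrightarrow> distinct (fst p) \<and> pattern_letters p = {1..k}"

text \<open>
  A set \<open>{x\<^sub>1 < \<dots> < x\<^sub>k} \<subseteq> [n]\<close> is given by its increasing enumeration \<open>x\<close>. The size
  \<open>k\<close> of an arrow pattern is the number of its letters.
\<close>

definition contains_arrow_pattern :: "nat list \<Rightarrow> arrow_pattern \<Rightarrow> bool" where
  "contains_arrow_pattern w p \<longleftrightarrow>
     (let \<nu> = fst p; H = snd p; m = length \<nu>; k = card (pattern_letters p) in
      \<exists>x t. strict_mono_on {1..k} x \<and> x ` {1..k} \<subseteq> {1..length w} \<and>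
            strict_mono_on {..<m} t \<and> t ` {..<m} \<subseteq> {..<length w} \<and>
            (\<forall>j<m. w ! t j = x (\<nu> ! j)) \<and>
            (\<forall>(b, c)\<in>H. hat w (x b) = x c))"

definition avoiders :: "nat \<Rightarrow> arrow_pattern \<Rightarrow> nat list set" where
  "avoiders n p = {w \<in> permutations_of_set {1..n}. \<not> contains_arrow_pattern w p}"

definition Bell :: "nat \<Rightarrow> nat" where
  "Bell n = card {P. partition_on {1..n} P}"

lemma hat_cycles_example: "hat_cycles [2,5,3,7,1,6,4] = [[2],[5,3],[7,1,6,4]]"
proof -
  have "lr_max_positions [2,5,3,7,1,6,4] = [0,1,3]"
    by (simp add: lr_max_positions_def lr_max_def upt_rec All_less_Suc numeral_eq_Suc)
  then show ?thesis by (simp add: hat_cycles_def numeral_eq_Suc)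
qed

lemma hat_example: "map (hat [2,5,3,7,1,6,4]) [1..<8] = [6,2,5,7,3,4,1]"
  unfolding hat_def hat_cycles_example by (simp add: upt_rec transpose_def)

lemma is_arrow_pattern_32_21: "is_arrow_pattern 3 ([3,2], {(2,1)})"
  by (auto simp: is_arrow_pattern_def pattern_letters_def)

end

theory Submission
  imports Defs
begin

text \<open>
  Under the map \<open>hat\<close>, an entry has a smaller image exactly when it is a descent top of the word, and
  its image is then the next entry. So \<open>w\<close> avoids the pattern iff every descent top is a
  left-to-right maximum. In such a word over \<open>A\<close>, the entries after \<open>Max A\<close> increase and
  the entries before it form a word of the same kind, so that the word amounts to a subset \<open>S\<close> of
  \<open>A - {Max A}\<close> and an avoiding word over \<open>A - {Max A} - S\<close>. Set partitions of \<open>A\<close> satisfy the same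
  recursion, with \<open>insert (Max A) S\<close> as the block of \<open>Max A\<close>.
\<close>

section \<open>Cycles of a word split at its maximum\<close>

lemma lr_max_append1: "i < length u \<Longrightarrow> lr_max (u @ v) i \<longleftrightarrow> lr_max u i"
  by (auto simp: lr_max_def nth_append)

text \<open>The entry \<open>m\<close> exceeds all of \<open>u\<close> and overshadows all of
  \<open>v\<close>, so from position \<open>length u\<close> on it alone opens a cycle.\<close>

lemma lr_max_append_Cons_max:
  assumes "\<forall>x\<in>set u. x < m" "\<forall>x\<in>set v. x < m" "length u \<le> i"
  shows "lr_max (u @ m # v) i \<longleftrightarrow> i = length u"
proof
  assume *: "lr_max (u @ m # v) i"
  show "i = length u"
  proof (rule ccontr)
    assume "i \<noteq> length u"
    then have i: "length u < i" using assms(3) by simp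
    then have "m < (u @ m # v) ! i"
      using * unfolding lr_max_def by (metis nth_append_length)
    moreover have "(u @ m # v) ! i \<in> set v"
      using * i by (auto simp: lr_max_def nth_append nth_Cons split: nat.splits)
    ultimately show False using assms(2) by fastforce
  qed
next
  assume "i = length u"
  then show "lr_max (u @ m # v) i"
    using assms(1) by (simp add: lr_max_def nth_append)
qed

lemma lr_max_positions_append_Cons_max:
  assumes "\<forall>x\<in>set u. x < m" "\<forall>x\<in>set v. x < m"
  shows "lr_max_positions (u @ m # v) = lr_max_positions u @ [length u]"
proof -
  have "[0..<length (u @ m # v)] = [0..<length u] @ length u # [Suc (length u)..<length (u @ m # v)]"
    using upt_add_eq_append[of 0 "length u" "Suc (length v)"] by (simp add: upt_conv_Cons del: upt_Suc)
  moreover have "filter (lr_max (u @ m # v)) [0..<length u] = lr_max_positions u"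
    unfolding lr_max_positions_def by (rule filter_cong) (auto simp: lr_max_append1)
  moreover have "filter (lr_max (u @ m # v)) [Suc (length u)..<length (u @ m # v)] = []"
    using lr_max_append_Cons_max[OF assms] by (auto simp: filter_empty_conv)
  moreover have "lr_max (u @ m # v) (length u)"
    using lr_max_append_Cons_max[OF assms] by simp
  ultimately show ?thesis
    unfolding lr_max_positions_def by (simp del: upt_Suc)
qed

lemma hat_cycles_append_Cons_max:
  assumes "\<forall>x\<in>set u. x < m" "\<forall>x\<in>set v. x < m"
  shows "hat_cycles (u @ m # v) = hat_cycles u @ [m # v]"
proof -
  let ?w = "u @ m # v" and ?L = "lr_max_positions u"
  let ?f = "\<lambda>w (s, e). take (e - s) (drop s w)"
  \<comment> \<open>The position \<open>length u\<close> serves twice: it closes the last cycle of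
    \<open>u\<close> and opens the cycle of \<open>m\<close>. If \<open>?L\<close> is empty, only
    the pair for \<open>m\<close> remains.\<close>
  have "zip (?L @ [length u]) (tl (?L @ [length u]) @ [length ?w])
      = zip ?L (tl ?L @ [length u]) @ [(length u, length ?w)]"
  proof (cases ?L)
    case (Cons a L)
    then show ?thesis
      using zip_append[of ?L "tl ?L @ [length u]" "[length u]" "[length ?w]"] by simp
  qed simp
  moreover have "map (?f ?w) (zip ?L (tl ?L @ [length u])) = hat_cycles u"
    unfolding hat_cycles_def
  proof (rule map_cong[OF refl], clarify)
    fix s e assume se: "(s, e) \<in> set (zip ?L (tl ?L @ [length u]))"
    \<comment> \<open>Both ends of the segment lie within \<open>u\<close>, so cutting it from the
      longer word gives the same list.\<close>
    have sub: "set ?L \<subseteq> {..<length u}"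
      by (auto simp: lr_max_positions_def)
    have "s < length u" using set_zip_leftD[OF se] sub by blast
    moreover have "e \<le> length u"
      using set_zip_rightD[OF se] sub by (cases ?L) auto
    ultimately show "take (e - s) (drop s ?w) = take (e - s) (drop s u)"
      by simp
  qed
  ultimately show ?thesis
    unfolding hat_cycles_def[of ?w] lr_max_positions_append_Cons_max[OF assms]
    by simp
qed

lemma foldr_comp_append:
  "foldr (\<circ>) (fs @ gs) id = foldr (\<circ>) fs id \<circ> foldr (\<circ>) gs id"
  by (induction fs) auto

lemma hat_append_Cons_max:
  assumes "\<forall>x\<in>set u. x < m" "\<forall>x\<in>set v. x < m"
  shows "hat (u @ m # v) = hat u \<circ> cycle_of_list (m # v)"
  unfolding hat_def hat_cycles_append_Cons_max[OF assms] map_append foldr_comp_append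
  by simp

lemma set_hat_cycles: "c \<in> set (hat_cycles w) \<Longrightarrow> set c \<subseteq> set w"
  unfolding hat_cycles_def by (auto dest!: in_set_takeD in_set_dropD)

lemma hat_outside: "x \<notin> set w \<Longrightarrow> hat w x = x"
proof -
  assume "x \<notin> set w"
  then have "\<forall>c\<in>set (hat_cycles w). x \<notin> set c"
    using set_hat_cycles by blast
  \<comment> \<open>The claim is stated for any list of these cycles so that the induction can drop
    the first one.\<close>
  then have "foldr (\<circ>) (map cycle_of_list cs) id x = x" if "set cs \<subseteq> set (hat_cycles w)" for cs
    using that by (induction cs) (auto simp: id_outside_supp)
  then show ?thesis by (simp add: hat_def)
qed

section \<open>Entries with a smaller image\<close>

lemma split_at_Max:
  fixes w :: "'a::linorder list"
  assumes "distinct w" "w \<noteq> []"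
  obtains u v where "w = u @ Max (set w) # v"
    "\<forall>x\<in>set u. x < Max (set w)" "\<forall>x\<in>set v. x < Max (set w)"
proof -
  have "Max (set w) \<in> set w" using assms(2) by simp
  then obtain u v where w: "w = u @ Max (set w) # v" by (meson split_list)
  have "x < Max (set w)" if "x \<in> set u \<union> set v" for x
  proof -
    have "x \<in> set w" using that by (subst w) auto
    moreover have "x \<noteq> Max (set w)"
      using assms(1) that by (subst (asm) w) auto
    ultimately show ?thesis by (simp add: order_less_le)
  qed
  then show thesis using w that by blast
qed

text \<open>Each entry goes to the next one in its cycle. The last entry of a cycle goes to the
  maximum opening that cycle, which is not smaller, while the entry following it in the word, if
  any, is a larger left-to-right maximum; both sides are then false. The induction strips the last
  cycle, which opens at the overall maximum.\<close>

lemma hat_eq_smaller_iff: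
  assumes "distinct w" "i < length w" "y < w ! i"
  shows "hat w (w ! i) = y \<longleftrightarrow> Suc i < length w \<and> w ! Suc i = y"
  using assms
proof (induction w arbitrary: i rule: length_induct)
  case (1 w)
  then have "w \<noteq> []" by auto
  from split_at_Max[OF 1(2) this] obtain u m v where w: "w = u @ m # v"
    and less: "\<forall>x\<in>set u. x < m" "\<forall>x\<in>set v. x < m" by metis
  have dist: "distinct u" "distinct (m # v)" "set u \<inter> set (m # v) = {}"
    using 1(2) w by auto
  have hat: "hat w x = hat u (cycle_of_list (m # v) x)" for x
    using hat_append_Cons_max[OF less] w by simp
  show ?case
  proof (cases "i < length u")
    case True
    then have wi: "w ! i = u ! i" "u ! i \<in> set u" by (simp_all add: w nth_append)
    \<comment> \<open>The cycle of \<open>m\<close> acts first and fixes the entries of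
      \<open>u\<close>.\<close>
    then have "cycle_of_list (m # v) (u ! i) = u ! i"
      using dist(3) by (intro id_outside_supp) auto
    then have "hat w (w ! i) = y \<longleftrightarrow> Suc i < length u \<and> u ! Suc i = y"
      using 1(1)[rule_format, of u i] 1(4) True wi dist(1) hat[of "u ! i"] by (simp add: w)
    \<comment> \<open>At the last position of \<open>u\<close> the next entry is \<open>m\<close>,
      which is therefore not \<open>y\<close>.\<close>
    moreover have "y < m" using 1(4) wi less by force
    ultimately show ?thesis using True
      by (cases "Suc i = length u") (auto simp: w nth_append)
  next
    case False
    define j where "j = i - length u"
    have j: "i = length u + j" "j < length (m # v)" using False 1(3) by (auto simp: j_def w)
    have wi: "w ! i = (m # v) ! j" by (simp add: w j(1))
    \<comment> \<open>One application of the cycle rotates its list of entries by one place.\<close>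
    have "map (cycle_of_list (m # v)) (m # v) = v @ [m]"
      using cyclic_rotation[of "m # v" 1] dist(2) by simp
    then have c: "cycle_of_list (m # v) ((m # v) ! j) = (v @ [m]) ! j"
      using j(2) by (metis nth_map)
    have "(v @ [m]) ! j \<in> set (v @ [m])" using j(2) by (intro nth_mem) simp
    then have "hat u ((v @ [m]) ! j) = (v @ [m]) ! j"
      using dist(3) by (intro hat_outside) auto
    then have "hat w (w ! i) = (v @ [m]) ! j" by (simp only: hat wi c)
    \<comment> \<open>This yields \<open>y < m\<close>, so at the last position of \<open>w\<close>,
      where the image is \<open>m\<close>, both sides are false.\<close>
    moreover have "w ! i \<le> m"
      using less(2) nth_mem[OF j(2)] unfolding wi by auto
    then have "y < m" using 1(4) by simp
    ultimately show ?thesis using j by (auto simp: w nth_append)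
  qed
qed

section \<open>Avoidance as a condition on descent tops\<close>

definition descent_tops_lr_max :: "nat list \<Rightarrow> bool" where
  "descent_tops_lr_max w \<longleftrightarrow> (\<forall>i. Suc i < length w \<longrightarrow> w ! Suc i < w ! i \<longrightarrow> lr_max w i)"

text \<open>The letters 2 and 1 must be adjacent and form a descent. An entry usable as letter 3 is
  a larger one further left, and it exists exactly when the descent top is no left-to-right
  maximum.\<close>

lemma contains_32_21_iff:
  assumes "w \<in> permutations_of_set {1..n}"
  shows "contains_arrow_pattern w ([3, 2], {(2, 1)}) \<longleftrightarrow> \<not> descent_tops_lr_max w"
    (is "?C \<longleftrightarrow> _")
proof -
  have dist: "distinct w" and set: "set w = {1..n}"
    using assms by (auto simp: permutations_of_set_def)
  then have len: "length w = n" by (metis card_atLeastAtMost diff_Suc_1 distinct_card)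
  have card: "card (pattern_letters ([3, 2], {(2, 1)})) = 3"
  proof -
    have "pattern_letters ([3, 2], {(2, 1)}) = {1, 2, 3}" by (auto simp: pattern_letters_def)
    then show ?thesis by simp
  qed
  have two: "{..<length [3, 2::nat]} = {0, 1}" by auto
  have three: "{1..3::nat} = {1, 2, 3}" by auto
  show ?thesis
  proof
    assume ?C
    then obtain x t where x: "strict_mono_on {1..3::nat} x"
      and t: "strict_mono_on {0, 1::nat} t" "t ` {0, 1} \<subseteq> {..<length w}"
      and wt: "\<forall>j<2. w ! t j = x ([3, 2] ! j)" and hat: "hat w (x 2) = x 1"
      unfolding contains_arrow_pattern_def Let_def card fst_conv snd_conv two by auto
    have xs: "x 1 < x 2" "x 2 < x 3" using x by (auto simp: strict_mono_on_def)
    have ts: "t 0 < t 1" "t 1 < length w" using t by (auto simp: strict_mono_on_def)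
    have ws: "w ! t 0 = x 3" "w ! t 1 = x 2" using wt by (auto simp: less_2_cases_iff)
    \<comment> \<open>Letter 2 stands at position \<open>t 1\<close>, and its image, letter 1, is
      smaller.\<close>
    have "Suc (t 1) < length w" "w ! Suc (t 1) = x 1"
      using hat_eq_smaller_iff[OF dist ts(2), of "x 1"] xs hat ws by auto
    moreover have "\<not> lr_max w (t 1)"
      using ts xs ws by (force simp: lr_max_def)
    ultimately show "\<not> descent_tops_lr_max w"
      using xs ws by (auto simp: descent_tops_lr_max_def)
  next
    assume "\<not> descent_tops_lr_max w"
    then obtain i where i: "Suc i < length w" "w ! Suc i < w ! i" "\<not> lr_max w i"
      by (auto simp: descent_tops_lr_max_def)
    then obtain j where j: "j < i" "\<not> w ! j < w ! i" by (auto simp: lr_max_def)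
    moreover have "w ! j \<noteq> w ! i" using i j dist by (simp add: nth_eq_iff_index_eq)
    ultimately have ji: "w ! i < w ! j" by simp
    \<comment> \<open>Letters 1, 2, 3 become the descent bottom, the descent top and the earlier
      larger entry at \<open>j\<close>.\<close>
    define x where "x k = (if k = 1 then w ! Suc i else if k = 2 then w ! i else w ! j)" for k :: nat
    define t where "t k = (if k = 0 then j else i)" for k :: nat
    have "hat w (w ! i) = w ! Suc i" using hat_eq_smaller_iff[OF dist _ i(2)] i by simp
    moreover have "{w ! Suc i, w ! i, w ! j} \<subseteq> {1..length w}"
      unfolding len set[symmetric] using i j by (auto intro!: nth_mem)
    ultimately show ?C
      unfolding contains_arrow_pattern_def Let_def card fst_conv snd_conv two three
      using i j ji
      by (intro exI[of _ x] exI[of _ t])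
        (auto simp: x_def t_def strict_mono_on_def less_Suc_eq)
  qed
qed

section \<open>Avoiding words split at their maximum\<close>

lemma descent_tops_lr_max_append_Cons_max:
  assumes "\<forall>x\<in>set u. x < m" "\<forall>x\<in>set v. x < m"
  shows "descent_tops_lr_max (u @ m # v) \<longleftrightarrow> descent_tops_lr_max u \<and> sorted v"
proof (intro iffI conjI)
  let ?w = "u @ m # v"
  assume *: "descent_tops_lr_max ?w"
  show "descent_tops_lr_max u"
    unfolding descent_tops_lr_max_def
  proof (intro allI impI)
    fix i assume "Suc i < length u" "u ! Suc i < u ! i"
    then have "lr_max ?w i"
      using *[unfolded descent_tops_lr_max_def, rule_format, of i] by (simp add: nth_append)
    then show "lr_max u i" using \<open>Suc i < length u\<close> lr_max_append1 by simp
  qed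
  show "sorted v"
    unfolding sorted_iff_nth_Suc
  proof (intro allI impI)
    fix j assume j: "Suc j < length v"
    \<comment> \<open>With \<open>m\<close> to its left, no entry of \<open>v\<close> is a
      left-to-right maximum, so none may be a descent top.\<close>
    have "\<not> lr_max ?w (length u + Suc j)"
      using lr_max_append_Cons_max[OF assms] by simp
    then show "v ! j \<le> v ! Suc j"
      using *[unfolded descent_tops_lr_max_def, rule_format, of "length u + Suc j"] j
      by (auto simp: nth_append simp flip: not_less)
  qed
next
  let ?w = "u @ m # v"
  assume *: "descent_tops_lr_max u \<and> sorted v"
  show "descent_tops_lr_max ?w"
    unfolding descent_tops_lr_max_def
  proof (intro allI impI)
    fix i assume i: "Suc i < length ?w" "?w ! Suc i < ?w ! i"
    \<comment> \<open>The cases are: both entries in \<open>u\<close>; the step up from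
      \<open>u\<close> to \<open>m\<close>, which is no descent; \<open>m\<close> itself, a
      left-to-right maximum; and both entries in the sorted \<open>v\<close>.\<close>
    consider "Suc i < length u" | "Suc i = length u" | "i = length u" | "length u < i" by linarith
    then show "lr_max ?w i"
    proof cases
      case 1
      then show ?thesis using * i by (simp add: descent_tops_lr_max_def nth_append lr_max_append1)
    next
      case 2
      then have "?w ! i \<in> set u" by (simp add: nth_append)
      moreover have "?w ! Suc i = m" using 2 by simp
      ultimately show ?thesis using i(2) assms(1) by force
    next
      case 3
      then show ?thesis using lr_max_append_Cons_max[OF assms] by simp
    next
      case 4
      then obtain j where "i = length u + Suc j" by (metis less_iff_Suc_add add_Suc_right)
      then show ?thesis using * i by (auto simp: nth_append sorted_iff_nth_Suc)
    qed
  qed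
qed

text \<open>Arbitrary ground sets are allowed because the recursion deletes arbitrary subsets of
  \<open>A\<close>.\<close>

definition avoiding_words :: "nat set \<Rightarrow> nat list set" where
  "avoiding_words A = {w \<in> permutations_of_set A. descent_tops_lr_max w}"

lemma finite_avoiding_words [simp]: "finite A \<Longrightarrow> finite (avoiding_words A)"
  by (simp add: avoiding_words_def)

lemma avoiding_words_empty: "avoiding_words {} = {[]}"
  by (auto simp: avoiding_words_def descent_tops_lr_max_def)

text \<open>\<open>S\<close> holds the entries after the maximum, whose order is forced to be
  increasing; \<open>u\<close> is the word before it.\<close>

lemma bij_betw_avoiding_words:
  assumes "finite A" "A \<noteq> {}"
  defines "m \<equiv> Max A"
  shows "bij_betw (\<lambda>(S, u). u @ m # sorted_list_of_set S)
    (SIGMA S:Pow (A - {m}). avoiding_words (A - {m} - S)) (avoiding_words A)"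
  unfolding bij_betw_def
proof (intro conjI equalityI subsetI)
  have m: "m \<in> A" "\<And>x. x \<in> A \<Longrightarrow> x \<noteq> m \<Longrightarrow> x < m"
    using assms by (auto simp: order_less_le)
  have fin: "finite S" if "S \<subseteq> A - {m}" for S
    using that assms(1) by (meson finite_Diff finite_subset)
  show "inj_on (\<lambda>(S, u). u @ m # sorted_list_of_set S)
    (SIGMA S:Pow (A - {m}). avoiding_words (A - {m} - S))"
  proof (rule inj_onI, clarify)
    fix S u T v
    assume S: "S \<subseteq> A - {m}" and T: "T \<subseteq> A - {m}"
      and u: "u \<in> avoiding_words (A - {m} - S)" and v: "v \<in> avoiding_words (A - {m} - T)"
      and eq: "u @ m # sorted_list_of_set S = v @ m # sorted_list_of_set T"
    \<comment> \<open>As \<open>m\<close> occurs in none of the four parts, the splitting at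
      \<open>m\<close> is unique.\<close>
    have "m \<notin> set u" "m \<notin> set v"
      using u v by (auto simp: avoiding_words_def permutations_of_set_def)
    moreover have "m \<notin> set (sorted_list_of_set S)"
      using S fin[OF S] by auto
    ultimately have "u = v \<and> sorted_list_of_set S = sorted_list_of_set T"
      using eq by (metis append_Cons_eq_iff)
    then show "S = T \<and> u = v"
      using fin[OF S] fin[OF T] by (metis set_sorted_list_of_set)
  qed
  fix w
  {
    assume "w \<in> (\<lambda>(S, u). u @ m # sorted_list_of_set S) `
      (SIGMA S:Pow (A - {m}). avoiding_words (A - {m} - S))"
    then obtain S u where S: "S \<subseteq> A - {m}" and u: "u \<in> avoiding_words (A - {m} - S)"
      and w: "w = u @ m # sorted_list_of_set S" by auto
    have set: "set u = A - {m} - S" "distinct u" "descent_tops_lr_max u"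
      using u by (auto simp: avoiding_words_def permutations_of_set_def)
    have "descent_tops_lr_max w"
      unfolding w using m S fin[OF S] set
      by (subst descent_tops_lr_max_append_Cons_max) auto
    moreover have "set w = A" "distinct w" using set m(1) S fin[OF S] by (auto simp: w)
    ultimately show "w \<in> avoiding_words A"
      by (simp add: avoiding_words_def permutations_of_set_def)
  next
    assume "w \<in> avoiding_words A"
    then have w: "set w = A" "distinct w" "descent_tops_lr_max w"
      by (auto simp: avoiding_words_def permutations_of_set_def)
    then have "w \<noteq> []" using assms(2) by auto
    from split_at_Max[OF w(2) this] obtain u v where uv: "w = u @ m # v"
      and less: "\<forall>x\<in>set u. x < m" "\<forall>x\<in>set v. x < m"
      unfolding w(1) m_def .
    have "descent_tops_lr_max u" "sorted v"
      using w(3) descent_tops_lr_max_append_Cons_max[OF less] uv by auto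
    \<comment> \<open>A sorted list without repetitions is recovered from its set, which makes
      \<open>set v\<close> the right choice of \<open>S\<close>.\<close>
    moreover from this have "sorted_list_of_set (set v) = v"
      using w(2) uv by (simp add: sorted_list_of_set.idem_if_sorted_distinct)
    moreover have "set u = A - {m} - set v" using w(1,2) uv by auto
    moreover have "set v \<subseteq> A - {m}" using w(1,2) uv by auto
    ultimately show "w \<in> (\<lambda>(S, u). u @ m # sorted_list_of_set S) `
      (SIGMA S:Pow (A - {m}). avoiding_words (A - {m} - S))"
      using w(2) uv
      by (intro image_eqI[of _ _ "(set v, u)"])
        (auto simp: avoiding_words_def permutations_of_set_def)
  }
qed

section \<open>The matching recursion for set partitions\<close>

lemma bij_betw_partition_on:
  assumes "a \<in> A"
  shows "bij_betw (\<lambda>(S, P). insert (insert a S) P)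
    (SIGMA S:Pow (A - {a}). {P. partition_on (A - {a} - S) P}) {P. partition_on A P}"
  unfolding bij_betw_def
proof (intro conjI equalityI subsetI)
  show "inj_on (\<lambda>(S, P). insert (insert a S) P)
    (SIGMA S:Pow (A - {a}). {P. partition_on (A - {a} - S) P})"
  proof (rule inj_onI, clarify)
    fix S P T Q
    assume S: "S \<subseteq> A - {a}" and T: "T \<subseteq> A - {a}"
      and P: "partition_on (A - {a} - S) P" and Q: "partition_on (A - {a} - T) Q"
      and eq: "insert (insert a S) P = insert (insert a T) Q"
    \<comment> \<open>Hence the block containing \<open>a\<close> is recognisable on both sides of
      \<open>eq\<close>, and removing it leaves \<open>P\<close> and \<open>Q\<close>.\<close>
    have a: "\<forall>B\<in>P \<union> Q. a \<notin> B"
      using partition_onD1[OF P] partition_onD1[OF Q] by blast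
    have "insert a S \<in> insert (insert a T) Q" using eq by (metis insertI1)
    then have eqB: "insert a S = insert a T" using a by auto
    then have "S = T" using S T by blast
    moreover have "insert a S \<notin> P" "insert a S \<notin> Q" using a by auto
    then have "P = Q" using eq unfolding eqB[symmetric] by (simp add: insert_ident)
    ultimately show "S = T \<and> P = Q" ..
  qed
  fix R
  {
    assume "R \<in> (\<lambda>(S, P). insert (insert a S) P) `
      (SIGMA S:Pow (A - {a}). {P. partition_on (A - {a} - S) P})"
    then obtain S P where S: "S \<subseteq> A - {a}" and P: "partition_on (A - {a} - S) P"
      and R: "R = insert (insert a S) P" by auto
    have "A - insert a S = A - {a} - S" by auto
    moreover have "disjnt (insert a S) (\<Union>P)"
      using partition_onD1[OF P] by (auto simp: disjnt_def)
    ultimately have "partition_on A R"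
      using P S assms R by (auto simp: partition_on_insert)
    then show "R \<in> {P. partition_on A P}" by simp
  next
    assume "R \<in> {P. partition_on A P}"
    then have R: "partition_on A R" by simp
    \<comment> \<open>The preimage of \<open>R\<close> is built from the block \<open>B\<close> of
      \<open>a\<close>: \<open>S\<close> is \<open>B - {a}\<close> and \<open>P\<close> is
      \<open>R - {B}\<close>.\<close>
    then obtain B where B: "B \<in> R" "a \<in> B" using assms by (auto simp: partition_on_def)
    have "insert B (R - {B}) = R" using B by auto
    moreover have "disjnt B (\<Union>(R - {B}))"
      using partition_onD2[OF R] B by (auto simp: disjoint_def disjnt_def)
    ultimately have "partition_on (A - B) (R - {B})" "B \<subseteq> A"
      using R partition_on_insert[of B "R - {B}" A] by auto
    moreover have "A - {a} - (B - {a}) = A - B" using B by auto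
    moreover have "insert a (B - {a}) = B" using B by auto
    ultimately show "R \<in> (\<lambda>(S, P). insert (insert a S) P) `
      (SIGMA S:Pow (A - {a}). {P. partition_on (A - {a} - S) P})"
      using B by (intro image_eqI[of _ _ "(B - {a}, R - {B})"]) auto
  }
qed

section \<open>Comparison of the two recursions\<close>

lemma card_avoiding_words:
  "finite A \<Longrightarrow> card (avoiding_words A) = card {P. partition_on A P}"
proof (induction A rule: finite_psubset_induct)
  case (psubset A)
  show ?case
  proof (cases "A = {}")
    case True
    then show ?thesis by (simp add: avoiding_words_empty partition_on_empty)
  next
    case False
    define m where "m = Max A"
    have m: "m \<in> A" using psubset.hyps False by (simp add: m_def)
    have fin: "finite (A - {m} - S)" for S using psubset.hyps by simp
    have "card (avoiding_words A) = (\<Sum>S\<in>Pow (A - {m}). card (avoiding_words (A - {m} - S)))"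
      using bij_betw_same_card[OF bij_betw_avoiding_words[OF psubset.hyps False]] fin psubset.hyps
      by (simp add: m_def)
    \<comment> \<open>Since \<open>m\<close> is removed, each \<open>A - {m} - S\<close> is a proper
      subset of \<open>A\<close>, as the induction hypothesis requires.\<close>
    also have "\<dots> = (\<Sum>S\<in>Pow (A - {m}). card {P. partition_on (A - {m} - S) P})"
      using m by (intro sum.cong refl psubset.IH) auto
    also have "\<dots> = card {P. partition_on A P}"
      using bij_betw_same_card[OF bij_betw_partition_on[OF m]] finitely_many_partition_on[OF fin] psubset.hyps
      by simp
    finally show ?thesis .
  qed
qed

theorem theorem6p2:
  fixes n :: nat
  assumes "n \<ge> 1"
  shows "card (avoiders n ([3, 2], {(2, 1)})) = Bell n"
proof -
  have "avoiders n ([3, 2], {(2, 1)}) = avoiding_words {1..n}"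
    unfolding avoiders_def avoiding_words_def using contains_32_21_iff by blast
  then show ?thesis by (simp add: card_avoiding_words Bell_def)
qed

end
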